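(* Let $p>1$, $\beta,b,M>0$, $y\in\mathbb{R}^N$, and let $R>0$ satisfy $$R\le\bar R:=\frac{\beta(p-1)^{\frac{p-1}{p}}}{p\,b^{\frac1p}\,M^{\frac{p-1}{p}}}.$$ Then there exists a radial (about $y$) solution $u$ of $$\beta\lambda_N(D^2u)+b|Du|^p=-M\ \text{ in }B_R(y),\qquad u=0\ \text{ on }\partial B_R(y),$$ such that $u\in C^2(\overline{B_R(y)})$ if $R<\bar R$, and $u\in C^2(B_R(y))\cap C^1(\overline{B_R(y)})$ if $R=\bar R$. Moreover $$\|u\|_{C^1(\overline{B_R(y)})}\le\left(\frac{\beta}{\bar R\,p\,b}\right)^{\frac1{p-1}}(\bar R+1).$$
   Context: For a real symmetric $N\times N$ matrix $X$, $\lambda_N(X)$ denotes its largest eigenvalue. $B_R(y)$ is the open ball of radius $R$ and center $y$ in $\mathbb{R}^N$. The norm is $\|u\|_{C^1(\overline{B_R(y)})}=\sup|u|+\sup|Du|$. *)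

theory Defs
  imports "HOL-Analysis.Analysis"
begin

definition eigenvalue :: "real^'n^'n \<Rightarrow> real \<Rightarrow> bool" where
  "eigenvalue X l \<longleftrightarrow> (\<exists>v. v \<noteq> 0 \<and> X *v v = l *\<^sub>R v)"

(* The set of eigenvalues is finite, and it is nonempty when X is symmetric;
   only symmetric X (Hessians of C^2 functions) are relevant. *)
definition largest_eigenvalue :: "real^'n^'n \<Rightarrow> real" where
  "largest_eigenvalue X = Max {l. eigenvalue X l}"

definition gradient :: "(real^'n \<Rightarrow> real) \<Rightarrow> real^'n \<Rightarrow> real^'n" where
  "gradient u x = (THE g. GDERIV u x :> g)"

definition hessian :: "(real^'n \<Rightarrow> real) \<Rightarrow> real^'n \<Rightarrow> real^'n^'n" where
  "hessian u x = jacobian (gradient u) (at x)"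

definition C1_on :: "(real^'n) set \<Rightarrow> (real^'n \<Rightarrow> real) \<Rightarrow> bool" where
  "C1_on \<Omega> u \<longleftrightarrow> (\<forall>x\<in>\<Omega>. u differentiable (at x)) \<and> continuous_on \<Omega> (gradient u)"

definition C2_on :: "(real^'n) set \<Rightarrow> (real^'n \<Rightarrow> real) \<Rightarrow> bool" where
  "C2_on \<Omega> u \<longleftrightarrow> C1_on \<Omega> u \<and> (\<forall>x\<in>\<Omega>. gradient u differentiable (at x))
     \<and> continuous_on \<Omega> (hessian u)"

definition extends_continuously ::
  "(real^'n) set \<Rightarrow> (real^'n \<Rightarrow> 'b::topological_space) \<Rightarrow> bool" where
  "extends_continuously \<Omega> f \<longleftrightarrow>
     (\<exists>g. continuous_on (closure \<Omega>) g \<and> (\<forall>x\<in>\<Omega>. g x = f x))"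

(* C^k of the closure of an open set: C^k inside, with all derivatives of order at most k
   extending continuously to the closure. The function itself is already given there, so it
   is required to be its own extension. *)
definition C1_closure :: "(real^'n) set \<Rightarrow> (real^'n \<Rightarrow> real) \<Rightarrow> bool" where
  "C1_closure \<Omega> u \<longleftrightarrow> C1_on \<Omega> u \<and> continuous_on (closure \<Omega>) u
     \<and> extends_continuously \<Omega> (gradient u)"

definition C2_closure :: "(real^'n) set \<Rightarrow> (real^'n \<Rightarrow> real) \<Rightarrow> bool" where
  "C2_closure \<Omega> u \<longleftrightarrow> C2_on \<Omega> u \<and> C1_closure \<Omega> u
     \<and> extends_continuously \<Omega> (hessian u)"

(* The continuous extension of the gradient to the closure of the open set (it does not
   depend on the values of u outside the closure). *)
definition gradient_closure :: "(real^'n) set \<Rightarrow> (real^'n \<Rightarrow> real) \<Rightarrow> real^'n \<Rightarrow> real^'n" where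
  "gradient_closure \<Omega> u x = Lim (at x within \<Omega>) (gradient u)"

(* Meaningful for bounded open nonempty \<Omega> and u satisfying C1_closure, where both
   suprema are over bounded sets. *)
definition C1_norm :: "(real^'n) set \<Rightarrow> (real^'n \<Rightarrow> real) \<Rightarrow> real" where
  "C1_norm \<Omega> u = (SUP x\<in>closure \<Omega>. \<bar>u x\<bar>)
     + (SUP x\<in>closure \<Omega>. norm (gradient_closure \<Omega> u x))"

definition radial_about :: "real^'n \<Rightarrow> (real^'n) set \<Rightarrow> (real^'n \<Rightarrow> real) \<Rightarrow> bool" where
  "radial_about y S u \<longleftrightarrow> (\<exists>\<phi>::real \<Rightarrow> real. \<forall>x\<in>S. u x = \<phi> (norm (x - y)))"

end

theory Submission
  imports Defs
begin

text \<open>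
  Look for \<open>u(x) = \<integral> v\<close> over \<open>[|x - y|, R]\<close> with \<open>v \<ge> 0\<close> and \<open>v(0) = 0\<close>. With \<open>r = |x - y|\<close>, the
  Hessian has the eigenvalue \<open>-v'(r)\<close> in the radial direction and \<open>-v(r)/r\<close> in the tangential ones.
  In dimension at least two, as long as \<open>v' \<ge> v/r\<close>, the equation is therefore the algebraic
  relation \<open>\<beta> v/r = M + b v\<^sup>p\<close>, that is \<open>r = H(v)\<close> with \<open>H(s) = \<beta> s/(M + b s\<^sup>p)\<close>. This \<open>H\<close> increases on
  \<open>[0, V]\<close>, where \<open>(p - 1) b V\<^sup>p = M\<close>, with \<open>H(V) = Rbar\<close> and \<open>H' \<le> \<beta>/(M + b s\<^sup>p)\<close>; hence its
  inverse \<open>v\<close> does satisfy \<open>v' \<ge> v/r\<close>, and \<open>v'\<close> blows up only at \<open>r = Rbar\<close>.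
  In dimension one there are no tangential directions: the equation becomes the differential equation
  \<open>\<beta> v' = M + b v\<^sup>p\<close>, solved by inverting \<open>H(s) = \<integral> \<beta>/(M + b t\<^sup>p) dt\<close> over \<open>[0, s]\<close>, for which
  \<open>H(V) \<ge> Rbar\<close> still holds.
  In both cases \<open>0 \<le> v \<le> V\<close>, and \<open>V\<close> is the constant in the norm bound.
\<close>

subsection \<open>Eigenvalues of the Hessian of a radial function\<close>

text \<open>The matrix \<open>- (w I + c s s^T)\<close>. For a unit vector \<open>s\<close> it acts
  as \<open>- (w + c)\<close> on the line through \<open>s\<close> and as \<open>- w\<close> on the
  orthogonal complement, like the Hessian of a radial function with radial direction
  \<open>s\<close>.\<close>

definition radial_matrix :: "real \<Rightarrow> real \<Rightarrow> real^'n \<Rightarrow> real^'n^'n" where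
  "radial_matrix w c s = (\<chi> i j. - (w * (if i = j then 1 else 0) + c * (s $ i * s $ j)))"

lemma radial_matrix_mult:
  "radial_matrix w c s *v h = - (w *\<^sub>R h + (c * (s \<bullet> h)) *\<^sub>R s)"
proof -
  have "(\<Sum>j\<in>UNIV. (- (w * (if i = j then 1 else 0) + c * (s $ i * s $ j))) * h $ j) 
      = - (w * h $ i) - c * (\<Sum>j\<in>UNIV. s $ j * h $ j) * s $ i" for i
  proof -
    have "(\<Sum>j\<in>UNIV. (- (w * (if i = j then 1 else 0) + c * (s $ i * s $ j))) * h $ j) 
        = (\<Sum>j\<in>UNIV. (if i = j then - w * h $ j else 0) - c * (s $ j * h $ j) * s $ i)"
      by (rule sum.cong) (auto simp: algebra_simps)
    then show ?thesis
      by (simp add: sum_subtractf sum_distrib_left sum_distrib_right)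
  qed
  then show ?thesis
    by (simp add: vec_eq_iff radial_matrix_def matrix_vector_mult_def inner_vec_def)
qed

text \<open>Pairing the eigenvector equation with \<open>s\<close> gives
  \<open>(l + w + c) * (s \<bullet> v) = 0\<close>. If \<open>v\<close> is orthogonal to
  \<open>s\<close>, the matrix multiplies it by \<open>- w\<close>.\<close>

lemma eigenvalue_radial_matrixD:
  assumes "eigenvalue (radial_matrix w c s) l" and "norm s = 1"
  shows "l = - w \<or> l = - (w + c)"
proof -
  obtain v where v: "v \<noteq> 0" "- (w *\<^sub>R v + (c * (s \<bullet> v)) *\<^sub>R s) = l *\<^sub>R v"
    using assms by (auto simp: eigenvalue_def radial_matrix_mult)
  have ss: "s \<bullet> s = 1" using assms by (simp add: norm_eq_1)
  show ?thesis
  proof (cases "s \<bullet> v = 0")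
    case True
    have "- (w *\<^sub>R v) = l *\<^sub>R v" using True v(2) by simp
    then have "(l + w) *\<^sub>R v = 0" by (metis add.commute add.right_inverse scaleR_add_left)
    then show ?thesis using v by (simp add: eq_neg_iff_add_eq_0)
  next
    case False
    have "- (w * (s \<bullet> v) + c * (s \<bullet> v)) = l * (s \<bullet> v)"
      using arg_cong[OF v(2), of "\<lambda>a. s \<bullet> a"] ss by (simp add: inner_add_right inner_diff_right)
    then have "(l + w + c) * (s \<bullet> v) = 0" by (simp add: algebra_simps)
    with False show ?thesis by auto
  qed
qed

lemma eigenvalue_radial_matrix_axis:
  assumes "norm s = 1" shows "eigenvalue (radial_matrix w c s) (- (w + c))"
  using assms unfolding eigenvalue_def radial_matrix_mult
  by (intro exI[of _ s]) (auto simp: norm_eq_1 algebra_simps)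

text \<open>In dimension at least two some nonzero vector is orthogonal to \<open>s\<close>, so both
  eigenvalues occur, and \<open>c \<ge> 0\<close> makes the tangential one the larger.\<close>

lemma largest_eigenvalue_radial_matrix:
  fixes s :: "real^'n"
  assumes "norm s = 1" "c \<ge> 0" "CARD('n) \<ge> 2"
  shows "largest_eigenvalue (radial_matrix w c s) = - w"
proof -
  obtain v :: "real^'n" where "v \<noteq> 0" "orthogonal s v"
    using orthogonal_to_vector_exists[of s] assms by auto
  then have "eigenvalue (radial_matrix w c s) (- w)"
    unfolding eigenvalue_def radial_matrix_mult
    by (intro exI[of _ v]) (auto simp: orthogonal_def)
  then have "{l. eigenvalue (radial_matrix w c s) l} = {- w, - (w + c)}"
    using eigenvalue_radial_matrixD[of w c s] eigenvalue_radial_matrix_axis[of s w c] assms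
    by blast
  then show ?thesis using assms by (simp add: largest_eigenvalue_def)
qed

text \<open>With \<open>c = 0\<close> the matrix is a multiple of the identity, whatever
  \<open>s\<close> is. This covers the center of the ball, where \<open>sgn (x - y)\<close> is
  0.\<close>

lemma largest_eigenvalue_radial_matrix_0:
  "largest_eigenvalue (radial_matrix w 0 (s :: real^'n)) = - w"
proof -
  have "{l. eigenvalue (radial_matrix w 0 s) l} = {- w}"
  proof -
    have "l = - w" if "v \<noteq> 0" "- (w *\<^sub>R v) = l *\<^sub>R v" for l and v :: "real^'n"
    proof -
      have "(l + w) *\<^sub>R v = 0" using that by (metis add.commute add.right_inverse scaleR_add_left)
      then show ?thesis using that by (simp add: eq_neg_iff_add_eq_0)
    qed
    moreover obtain v :: "real^'n" where "v \<noteq> 0" by (metis zero_neq_one)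
    ultimately show ?thesis by (auto simp: eigenvalue_def radial_matrix_mult)
  qed
  then show ?thesis by (simp add: largest_eigenvalue_def)
qed

text \<open>With a single coordinate, \<open>s s^T\<close> is the number 1, so only the radial
  eigenvalue is left.\<close>

lemma largest_eigenvalue_radial_matrix_dim1:
  fixes s :: "real^'n"
  assumes "norm s = 1" "CARD('n) = 1"
  shows "largest_eigenvalue (radial_matrix w c s) = - (w + c)"
proof -
  obtain i where i: "UNIV = {i :: 'n}" using assms by (metis card_1_singletonE)
  have j: "j = i" for j using i by auto
  have "s $ i * s $ i = 1" using assms unfolding norm_eq_1 inner_vec_def i by simp
  then have "c * (s $ k * s $ j) = c" for j k :: 'n using j[of j] j[of k] by simp
  then have "radial_matrix w c s = radial_matrix (w + c) 0 s"
    using j by (simp add: radial_matrix_def vec_eq_iff) metis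
  then show ?thesis by (simp add: largest_eigenvalue_radial_matrix_0)
qed

subsection \<open>Gradient and Hessian of a radial function\<close>

lemma gradient_eq: "GDERIV u x :> g \<Longrightarrow> gradient u x = g"
  unfolding gradient_def
proof (rule the_equality)
  fix h assume "GDERIV u x :> g" "GDERIV u x :> h"
  then have "(\<lambda>k. k \<bullet> h) = (\<lambda>k. k \<bullet> g)"
    unfolding gderiv_def by (rule has_derivative_unique[rotated])
  from fun_cong[OF this, of "h - g"] have "(h - g) \<bullet> (h - g) = 0" by (simp add: inner_diff_right)
  then show "h = g" by simp
qed

lemma sgn_mult_norm: "norm x *\<^sub>R sgn x = (x :: 'a :: real_normed_vector)"
  by (cases "x = 0") (simp_all add: sgn_div_norm)

text \<open>Here \<open>v\<close> is minus the slope of the radial function and \<open>v1\<close> is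
  the derivative of \<open>v\<close>. The endpoint \<open>R\<close> is left out of the last two
  assumptions because the slope of \<open>v\<close> may blow up there in the critical case.\<close>

locale radial_profile =
  fixes R :: real and v v1 :: "real \<Rightarrow> real"
  assumes R_pos: "0 < R" and cont_v: "continuous_on {0..R} v" and v_0: "v 0 = 0"
    and deriv_v: "\<And>r. r \<in> {0..<R} \<Longrightarrow> (v has_real_derivative v1 r) (at r within {0..R})"
    and cont_v1: "continuous_on {0..<R} v1"
begin

text \<open>Minus the tangential eigenvalue, extended to the center by its limit; the bare quotient
  would take the default value 0 there.\<close>

definition w :: "real \<Rightarrow> real" where "w r = (if r = 0 then v1 0 else v r / r)"

lemma mult_w: "r * w r = v r"
  by (simp add: w_def v_0)

lemma DERIV_v: "0 < r \<Longrightarrow> r < R \<Longrightarrow> DERIV v r :> v1 r"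
  using deriv_v[of r] at_within_Icc_at[of 0 r R] by simp

text \<open>At 0 the function \<open>w\<close> is the difference quotient of \<open>v\<close>,
  because \<open>v 0 = 0\<close>, and this tends to \<open>v1 0\<close>.\<close>

lemma cont_w: "continuous_on {0..R} w"
  unfolding continuous_on_def
proof
  fix r assume r: "r \<in> {0..R}"
  show "(w \<longlongrightarrow> w r) (at r within {0..R})"
  proof (cases "r = 0")
    case True
    have "((\<lambda>x. (v x - v 0) / (x - 0)) \<longlongrightarrow> v1 0) (at 0 within {0..R})"
      using deriv_v[of 0] R_pos by (simp add: has_field_derivative_iff)
    then have "(w \<longlongrightarrow> v1 0) (at 0 within {0..R})"
      by (rule Lim_transform_eventually) (auto simp: eventually_at_filter w_def v_0)
    then show ?thesis by (simp add: True w_def[of 0])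
  next
    case False
    have "((\<lambda>x. v x / x) \<longlongrightarrow> v r / r) (at r within {0..R})"
      using cont_v r False by (intro tendsto_divide tendsto_ident_at) (auto simp: continuous_on_def)
    moreover have "\<forall>\<^sub>F x in at r within {0..R}. v x / x = w x"
      using eventually_neq_at_within[of 0 r] by eventually_elim (simp add: w_def)
    ultimately have "(w \<longlongrightarrow> v r / r) (at r within {0..R})"
      by (rule Lim_transform_eventually)
    then show ?thesis using False by (simp add: w_def[of r])
  qed
qed

lemma DERIV_w:
  assumes "0 < r" "r < R"
  shows "DERIV w r :> (v1 r - w r) / r"
proof -
  have "DERIV (\<lambda>x. v x / x) r :> (v1 r * r - v r * 1) / (r * r)"
    using assms by (intro DERIV_divide DERIV_v DERIV_ident) auto
  then have "DERIV (\<lambda>x. v x / x) r :> (v1 r - w r) / r"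
    using assms by (simp add: w_def field_simps)
  then show ?thesis
    by (rule has_field_derivative_transform_within_open[where S = "{0<..}"])
      (use assms in \<open>auto simp: w_def\<close>)
qed

definition \<phi> :: "real \<Rightarrow> real" where "\<phi> r = integral {r..R} v"

lemma deriv_\<phi>: "r \<in> {0..R} \<Longrightarrow> (\<phi> has_real_derivative - v r) (at r within {0..R})"
  unfolding \<phi>_def using integral_has_real_derivative'[OF cont_v] .

lemma DERIV_\<phi>: "0 < r \<Longrightarrow> r < R \<Longrightarrow> DERIV \<phi> r :> - v r"
  using deriv_\<phi>[of r] at_within_Icc_at[of 0 r R] by simp

context
  fixes y :: "real^'n"
begin

definition u :: "real^'n \<Rightarrow> real" where "u x = \<phi> (norm (x - y))"
text \<open>Using \<open>w\<close> and \<open>x - y\<close> instead of \<open>v\<close> and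
  \<open>sgn (x - y)\<close> gives one formula that is visibly continuous through the center. It
  also makes sense on the sphere and so serves as the continuous extension of the gradient.\<close>

definition grad :: "real^'n \<Rightarrow> real^'n" where "grad x = - (w (norm (x - y)) *\<^sub>R (x - y))"
definition hess :: "real^'n \<Rightarrow> real^'n^'n" where
  "hess x = radial_matrix (w (norm (x - y))) (v1 (norm (x - y)) - w (norm (x - y))) (sgn (x - y))"

lemma GDERIV_norm_diff: "x \<noteq> y \<Longrightarrow> GDERIV (\<lambda>x. norm (x - y)) x :> sgn (x - y)"
  unfolding gderiv_def
  by (rule has_derivative_compose[where f = "\<lambda>x. x - y" and f' = "\<lambda>h. h" and g = norm])
    (auto intro!: derivative_eq_intros has_derivative_norm)

text \<open>Turns one-sided limits in the radius at 0 into limits at the center.\<close>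

lemma filterlim_norm_diff: "filterlim (\<lambda>x. norm (x - y)) (at 0 within {0..R}) (at y)"
  unfolding filterlim_at
proof
  show "((\<lambda>x. norm (x - y)) \<longlongrightarrow> 0) (at y)"
    by (rule tendsto_eq_intros | simp)+
  have "\<forall>\<^sub>F x in at y. dist x y < R" using R_pos
    by (auto simp: eventually_at)
  then show "\<forall>\<^sub>F x in at y. norm (x - y) \<in> {0..R} \<and> norm (x - y) \<noteq> 0"
    using eventually_neq_at_within[of y] by eventually_elim (auto simp: dist_norm)
qed

text \<open>Away from the center this is the chain rule. At the center the norm is not
  differentiable, but the one-sided slope of \<open>\<phi>\<close> at 0 is \<open>- v 0 = 0\<close>,
  so \<open>u x - u y\<close> is of smaller order than \<open>norm (x - y)\<close>.\<close>

lemma GDERIV_u: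
  assumes "x \<in> ball y R"
  shows "GDERIV u x :> grad x"
proof (cases "x = y")
  case True
  have "((\<lambda>r. (\<phi> r - \<phi> 0) / (r - 0)) \<longlongrightarrow> 0) (at 0 within {0..R})"
    using deriv_\<phi>[of 0] R_pos by (simp add: has_field_derivative_iff v_0)
  from filterlim_compose[OF this filterlim_norm_diff]
  have "((\<lambda>x. (\<phi> (norm (x - y)) - \<phi> 0) / norm (x - y)) \<longlongrightarrow> 0) (at y)" by simp
  then have "((\<lambda>x. norm (u x - u y) / norm (x - y)) \<longlongrightarrow> 0) (at y)"
    by (subst (asm) tendsto_norm_zero_iff[symmetric]) (simp add: u_def)
  then have "(u has_derivative (\<lambda>h. 0)) (at y)"
    by (subst has_derivative_iff_norm) simp
  then show ?thesis unfolding True by (simp add: gderiv_def grad_def)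
next
  case False
  have "norm (x - y) < R" using assms by (simp add: dist_norm norm_minus_commute)
  then have "GDERIV (\<lambda>x. \<phi> (norm (x - y))) x :> (- v (norm (x - y))) *\<^sub>R sgn (x - y)"
    using False by (intro GDERIV_DERIV_compose GDERIV_norm_diff DERIV_\<phi>) auto
  moreover have "(- v (norm (x - y))) *\<^sub>R sgn (x - y) = grad x"
    using False by (simp add: grad_def w_def sgn_div_norm field_simps)
  ultimately show ?thesis by (simp add: u_def[abs_def])
qed

lemma gradient_u: "x \<in> ball y R \<Longrightarrow> gradient u x = grad x"
  by (rule gradient_eq[OF GDERIV_u])

lemma cont_grad: "continuous_on (cball y R) grad"
  unfolding grad_def
  by (intro continuous_intros continuous_on_compose2[OF cont_w])
    (auto simp: dist_norm norm_minus_commute)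

lemma cont_u: "continuous_on (cball y R) u"
proof -
  have "continuous_on {0..R} \<phi>" using deriv_\<phi> by (rule DERIV_continuous_on)
  then show ?thesis unfolding u_def
    by (rule continuous_on_compose2)
      (auto simp: dist_norm norm_minus_commute intro!: continuous_intros)
qed

text \<open>At the center the remainder is
  \<open>(v1 0 - w (norm (x - y))) *\<^sub>R (x - y)\<close>, which is of smaller order by
  continuity of \<open>w\<close> at 0. Elsewhere the product and chain rules apply.\<close>

lemma grad_has_derivative:
  assumes "x \<in> ball y R"
  shows "(grad has_derivative (\<lambda>h. hess x *v h)) (at x)"
proof (cases "x = y")
  case True
  have "hess y *v h = - (v1 0 *\<^sub>R h)" for h
    by (simp add: hess_def radial_matrix_mult w_def)
  moreover have "(grad has_derivative (\<lambda>h. - (v1 0 *\<^sub>R h))) (at y)"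
  proof (subst has_derivative_iff_norm, intro conjI)
    have "(w \<longlongrightarrow> v1 0) (at 0 within {0..R})"
      using cont_w[unfolded continuous_on_def, rule_format, of 0] R_pos by (simp add: w_def[of 0])
    from filterlim_compose[OF this filterlim_norm_diff]
    have "((\<lambda>x. \<bar>v1 0 - w (norm (x - y))\<bar>) \<longlongrightarrow> \<bar>v1 0 - v1 0\<bar>) (at y)"
      by (intro tendsto_intros)
    then have *: "((\<lambda>x. \<bar>v1 0 - w (norm (x - y))\<bar>) \<longlongrightarrow> 0) (at y)" by simp
    have "grad x - grad y - - (v1 0 *\<^sub>R (x - y)) = (v1 0 - w (norm (x - y))) *\<^sub>R (x - y)" for x
      by (simp add: grad_def algebra_simps)
    then show "((\<lambda>x. norm (grad x - grad y - - (v1 0 *\<^sub>R (x - y))) / norm (x - y)) \<longlongrightarrow> 0) (at y)"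
      by (intro Lim_transform_eventually[OF *]) (simp add: eventually_at_filter)
  qed (intro bounded_linear_minus bounded_linear_scaleR_right)
  ultimately show ?thesis by (simp add: True)
next
  case False
  let ?r = "norm (x - y)" and ?s = "sgn (x - y)"
  have r: "0 < ?r" "?r < R" using False assms by (auto simp: dist_norm norm_minus_commute)
  have "((\<lambda>x. w (norm (x - y))) has_derivative (\<lambda>h. h \<bullet> (((v1 ?r - w ?r) / ?r) *\<^sub>R ?s))) (at x)"
    using GDERIV_DERIV_compose[OF GDERIV_norm_diff[OF False] DERIV_w[OF r]] by (simp add: gderiv_def)
  then have "(grad has_derivative
      (\<lambda>h. - (w ?r *\<^sub>R h + (h \<bullet> (((v1 ?r - w ?r) / ?r) *\<^sub>R ?s)) *\<^sub>R (x - y)))) (at x)"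
    unfolding grad_def[abs_def]
    by (intro has_derivative_minus has_derivative_scaleR)
      (auto intro!: derivative_eq_intros)
  \<comment> \<open>The factor \<open>1 / ?r\<close> from the derivative of \<open>w\<close> cancels
    against \<open>x - y = ?r *\<^sub>R ?s\<close>.\<close>
  moreover have "(h \<bullet> (((v1 ?r - w ?r) / ?r) *\<^sub>R ?s)) *\<^sub>R (x - y) = ((v1 ?r - w ?r) * (?s \<bullet> h)) *\<^sub>R ?s" for h
  proof -
    have "(h \<bullet> (((v1 ?r - w ?r) / ?r) *\<^sub>R ?s)) *\<^sub>R (x - y)
        = (h \<bullet> (((v1 ?r - w ?r) / ?r) *\<^sub>R ?s)) *\<^sub>R (?r *\<^sub>R ?s)"
      by (simp only: sgn_mult_norm)
    then show ?thesis using r by (simp add: inner_commute)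
  qed
  ultimately show ?thesis by (simp add: hess_def radial_matrix_mult)
qed

lemma gradient_has_derivative:
  assumes "x \<in> ball y R"
  shows "(gradient u has_derivative (\<lambda>h. hess x *v h)) (at x)"
  by (rule has_derivative_transform_within_open[OF grad_has_derivative[OF assms], of "ball y R"])
    (use assms gradient_u in auto)

lemma hessian_u:
  assumes "x \<in> ball y R"
  shows "hessian u x = hess x"
  unfolding hessian_def jacobian_def frechet_derivative_at[OF gradient_has_derivative[OF assms], symmetric]
  by (rule matrix_of_matrix_vector_mul)

text \<open>\<open>sgn (x - y)\<close> jumps at \<open>x = y\<close>, but its coefficient \<open>v1 - w\<close> tends to 0 there.\<close>
lemma cont_hess:
  assumes "continuous_on D v1" "D \<subseteq> {0..R}" "\<And>x. x \<in> A \<Longrightarrow> norm (x - y) \<in> D"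
  shows "continuous_on A hess"
proof -
  define c where "c r = v1 r - w r" for r
  have cD: "continuous_on D c" unfolding c_def
    by (intro continuous_intros assms continuous_on_subset[OF cont_w])
  have cW: "continuous_on A (\<lambda>x. w (norm (x - y)))"
    by (rule continuous_on_compose2[OF cont_w]) (use assms in \<open>auto intro!: continuous_intros\<close>)
  have cC: "continuous_on A (\<lambda>x. c (norm (x - y)))"
    by (rule continuous_on_compose2[OF cD]) (use assms in \<open>auto intro!: continuous_intros\<close>)
  have "continuous_on A (\<lambda>x. c (norm (x - y)) * (sgn (x - y) $ i * sgn (x - y) $ j))" for i j
    unfolding continuous_on_def
  proof
    fix x assume x: "x \<in> A"
    have lim: "((\<lambda>x. c (norm (x - y))) \<longlongrightarrow> c (norm (x - y))) (at x within A)"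
      using cC x by (simp add: continuous_on_def)
    show "((\<lambda>x. c (norm (x - y)) * (sgn (x - y) $ i * sgn (x - y) $ j)) \<longlongrightarrow>
        c (norm (x - y)) * (sgn (x - y) $ i * sgn (x - y) $ j)) (at x within A)"
    proof (cases "x = y")
      case True
      have "\<bar>sgn z $ k\<bar> \<le> 1" for z :: "real^'n" and k
        using component_le_norm_cart[of "sgn z" k] by (simp add: norm_sgn split: if_splits)
      then have "\<bar>sgn z $ i\<bar> * \<bar>sgn z $ j\<bar> \<le> 1" for z :: "real^'n"
        using mult_mono[of "\<bar>sgn z $ i\<bar>" 1 "\<bar>sgn z $ j\<bar>" 1] by simp
      then have "norm (c (norm (x - y)) * (sgn (x - y) $ i * sgn (x - y) $ j)) \<le> norm (c (norm (x - y)))" for x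
        by (simp add: abs_mult mult_left_le)
      then have "\<forall>\<^sub>F x in at x within A.
          norm (c (norm (x - y)) * (sgn (x - y) $ i * sgn (x - y) $ j)) \<le> norm (c (norm (x - y)))"
        by (intro always_eventually allI)
      moreover have "((\<lambda>x. norm (c (norm (x - y)))) \<longlongrightarrow> 0) (at x within A)"
        using tendsto_norm[OF lim] True by (simp add: c_def w_def)
      ultimately have "((\<lambda>x. c (norm (x - y)) * (sgn (x - y) $ i * sgn (x - y) $ j)) \<longlongrightarrow> 0) (at x within A)"
        by (rule Lim_null_comparison)
      then show ?thesis using True by simp
    next
      case False
      then have "((\<lambda>x. sgn (x - y)) \<longlongrightarrow> sgn (x - y)) (at x within A)"
        by (intro tendsto_sgn tendsto_diff tendsto_const tendsto_ident_at) simp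
      then show ?thesis by (intro tendsto_mult lim tendsto_vec_nth)
    qed
  qed
  moreover have "continuous_on A (\<lambda>x. w (norm (x - y)) * k)" for k
    by (intro continuous_on_mult cW continuous_on_const)
  ultimately show ?thesis
    unfolding hess_def[abs_def] radial_matrix_def c_def
    by (intro continuous_on_vec_lambda continuous_on_minus continuous_on_add)
qed

section \<open>Regularity up to the boundary and the norm bound\<close>

lemma C1_on_u: "C1_on (ball y R) u"
  unfolding C1_on_def
proof
  show "\<forall>x\<in>ball y R. u differentiable at x"
    using GDERIV_u unfolding gderiv_def differentiable_def by blast
  show "continuous_on (ball y R) (gradient u)"
    by (rule continuous_on_eq[OF continuous_on_subset[OF cont_grad ball_subset_cball]])
      (rule gradient_u[symmetric])
qed

lemma C1_closure_u: "C1_closure (ball y R) u"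
  unfolding C1_closure_def extends_continuously_def closure_ball[OF R_pos]
  by (intro conjI C1_on_u cont_u exI[of _ grad] cont_grad ballI gradient_u[symmetric])

lemma C2_on_u: "C2_on (ball y R) u"
  unfolding C2_on_def
proof (intro conjI C1_on_u ballI)
  show "gradient u differentiable at x" if "x \<in> ball y R" for x
    using gradient_has_derivative[OF that] unfolding differentiable_def by blast
  have "continuous_on (ball y R) hess"
    by (rule cont_hess[OF cont_v1]) (auto simp: dist_norm norm_minus_commute)
  then show "continuous_on (ball y R) (hessian u)"
    by (rule continuous_on_eq) (rule hessian_u[symmetric])
qed

lemma C2_closure_u:
  assumes "continuous_on {0..R} v1"
  shows "C2_closure (ball y R) u"
proof -
  have "continuous_on (cball y R) hess"
    by (rule cont_hess[OF assms]) (auto simp: dist_norm norm_minus_commute)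
  then show ?thesis
    unfolding C2_closure_def extends_continuously_def closure_ball[OF R_pos]
    by (intro conjI C2_on_u C1_closure_u exI[of _ hess] ballI hessian_u[symmetric])
qed

text \<open>Every point of the closed ball is a limit point of the open ball, so the limit defining
  the extension is unique; the continuous function \<open>grad\<close> provides it.\<close>

lemma gradient_closure_u:
  assumes "x \<in> cball y R"
  shows "gradient_closure (ball y R) u x = grad x"
  unfolding gradient_closure_def
proof (rule tendsto_Lim)
  have "x islimpt ball y R" using assms R_pos unfolding islimpt_ball by blast
  then show "at x within ball y R \<noteq> bot" unfolding trivial_limit_within by blast
  have "(grad \<longlongrightarrow> grad x) (at x within ball y R)"
    using cont_grad[unfolded continuous_on_def, rule_format, OF assms] ball_subset_cball
    by (rule tendsto_within_subset)
  moreover have "\<forall>\<^sub>F z in at x within ball y R. grad z = gradient u z"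
    unfolding eventually_at_filter by (intro always_eventually allI impI) (rule gradient_u[symmetric])
  ultimately show "(gradient u \<longlongrightarrow> grad x) (at x within ball y R)"
    by (rule Lim_transform_eventually)
qed

lemma norm_grad: "norm (grad x) = \<bar>v (norm (x - y))\<bar>"
  unfolding grad_def by (subst mult_w[symmetric]) (simp add: abs_mult)

text \<open>The gradient has norm \<open>v\<close>, hence at most \<open>V\<close>, and
  \<open>u\<close> is an integral of \<open>v\<close> over an interval of length at most
  \<open>R\<close>.\<close>

lemma C1_norm_u:
  assumes V: "\<And>r. r \<in> {0..R} \<Longrightarrow> v r \<in> {0..V}"
  shows "C1_norm (ball y R) u \<le> V * (R + 1)"
proof -
  have ne: "cball y R \<noteq> {}" using R_pos by simp
  have r: "norm (x - y) \<in> {0..R}" if "x \<in> cball y R" for x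
    using that by (simp add: dist_norm norm_minus_commute)
  have "(SUP x\<in>cball y R. \<bar>u x\<bar>) \<le> V * R"
  proof (rule cSUP_least[OF ne])
    fix x assume x: "x \<in> cball y R"
    then have sub: "{norm (x - y)..R} \<subseteq> {0..R}" by auto
    have "norm (integral {norm (x - y)..R} v) \<le> V * (R - norm (x - y))"
    proof (rule integral_bound)
      show "continuous_on {norm (x - y)..R} v" using cont_v sub by (rule continuous_on_subset)
      show "norm (v t) \<le> V" if "t \<in> {norm (x - y)..R}" for t
      proof -
        have "t \<in> {0..R}" using sub that by blast
        then show ?thesis using V[of t] by simp
      qed
    qed (use r[OF x] in simp)
    also have "\<dots> \<le> V * R" using r[OF x] V[of 0] R_pos by (intro mult_left_mono) auto
    finally show "\<bar>u x\<bar> \<le> V * R" by (simp add: u_def \<phi>_def)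
  qed
  moreover have "(SUP x\<in>cball y R. norm (gradient_closure (ball y R) u x)) \<le> V"
  proof (rule cSUP_least[OF ne])
    fix x assume x: "x \<in> cball y R"
    show "norm (gradient_closure (ball y R) u x) \<le> V"
      unfolding gradient_closure_u[OF x] norm_grad using V[OF r[OF x]] by simp
  qed
  ultimately show ?thesis
    unfolding C1_norm_def closure_ball[OF R_pos] by (simp add: algebra_simps)
qed

end

end

subsection \<open>Profiles solving the equation\<close>

text \<open>A positive derivative makes \<open>H\<close> strictly increasing, so it has a continuous
  inverse on its compact image. Differentiability of the inverse is claimed only below
  \<open>H V\<close>, since \<open>H\<close> may have zero slope at \<open>V\<close>.\<close>

lemma increasing_inverse:
  fixes H H1 :: "real \<Rightarrow> real"
  assumes V: "V > 0" and H0: "H 0 = 0" and R: "0 \<le> R" "R \<le> H V"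
    and cont: "continuous_on {0..V} H"
    and deriv: "\<And>s. s \<in> {0..<V} \<Longrightarrow> (H has_real_derivative H1 s) (at s within {0..V})"
    and pos: "\<And>s. s \<in> {0..<V} \<Longrightarrow> H1 s > 0"
  obtains v where "\<And>r. r \<in> {0..R} \<Longrightarrow> v r \<in> {0..V}" "\<And>r. r \<in> {0..R} \<Longrightarrow> H (v r) = r"
    "continuous_on {0..R} v" "v 0 = 0" "\<And>r. r \<in> {0..R} \<Longrightarrow> r < H V \<Longrightarrow> v r \<in> {0..<V}"
    "\<And>r. r \<in> {0..R} \<Longrightarrow> r < H V \<Longrightarrow>
       (v has_real_derivative inverse (H1 (v r))) (at r within {0..R})"
proof -
  have mono: "H a < H c" if "0 \<le> a" "a < c" "c \<le> V" for a c
  proof (rule DERIV_pos_imp_increasing_open[OF \<open>a < c\<close>])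
    fix x assume x: "a < x" "x < c"
    have "(H has_real_derivative H1 x) (at x within {0<..<V})"
      using deriv[of x] x that by (auto intro: DERIV_subset)
    then have "DERIV H x :> H1 x" using x that by (simp add: at_within_open[of x "{0<..<V}"])
    then show "\<exists>y. DERIV H x :> y \<and> y > 0" using pos[of x] x that by auto
  next
    show "continuous_on {a..c} H" using cont by (rule continuous_on_subset) (use that in auto)
  qed
  then have inj: "inj_on H {0..V}"
    by (intro linorder_inj_onI) force+
  define v where "v = inv_into {0..V} H"
  have img: "r \<in> H ` {0..V}" if "r \<in> {0..R}" for r
    using IVT'[of H 0 r V] that cont R V H0 by fastforce
  have v: "v r \<in> {0..V}" "H (v r) = r" if "r \<in> {0..R}" for r
    using img[OF that] unfolding v_def by (simp_all only: f_inv_into_f inv_into_into)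
  have contv: "continuous_on {0..R} v"
  proof (rule continuous_on_subset)
    show "continuous_on (H ` {0..V}) v"
      by (rule continuous_on_inv[OF cont]) (auto simp: v_def inj)
  qed (use img in auto)
  have v0: "v 0 = 0" unfolding v_def using inv_into_f_f[OF inj, of 0] V H0 by simp
  have vless: "v r \<in> {0..<V}" if "r \<in> {0..R}" "r < H V" for r
    using v[OF that(1)] that(2) by (cases "v r = V") auto
  have dv: "(v has_real_derivative inverse (H1 (v r))) (at r within {0..R})"
    if r: "r \<in> {0..R}" "r < H V" for r
  proof -
    \<comment> \<open>The derivative of the inverse is computed as the limit of reciprocal
      difference quotients of \<open>H\<close> along \<open>v\<close>. This works within the closed
      interval, in particular one-sidedly at 0.\<close>
    let ?q = "\<lambda>s. (H s - H (v r)) / (s - v r)"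
    have "(?q \<longlongrightarrow> H1 (v r)) (at (v r) within {0..V})"
      using deriv[OF vless[OF r]] by (simp add: has_field_derivative_iff)
    moreover have "filterlim v (at (v r) within {0..V}) (at r within {0..R})"
      unfolding filterlim_at
    proof
      show "(v \<longlongrightarrow> v r) (at r within {0..R})"
        using contv r by (simp add: continuous_on_def)
      show "\<forall>\<^sub>F x in at r within {0..R}. v x \<in> {0..V} \<and> v x \<noteq> v r"
        unfolding eventually_at_filter using v r by (intro always_eventually) metis
    qed
    ultimately have "((\<lambda>x. inverse (?q (v x))) \<longlongrightarrow> inverse (H1 (v r))) (at r within {0..R})"
      using pos[OF vless[OF r]] by (intro tendsto_inverse) (auto dest: filterlim_compose)
    then have "((\<lambda>x. (v x - v r) / (x - r)) \<longlongrightarrow> inverse (H1 (v r))) (at r within {0..R})"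
      by (rule Lim_transform_eventually)
        (use v r in \<open>auto simp: eventually_at_filter field_simps\<close>)
    then show ?thesis by (simp add: has_field_derivative_iff)
  qed
  show ?thesis using that[OF v(1) v(2) contv v0 vless dv] .
qed

text \<open>\<open>H\<close> is the inverse of the profile \<open>v\<close>, and \<open>f s\<close> stands for \<open>M + b s\<^sup>p\<close>.\<close>
lemma radial_solution:
  fixes H H1 f :: "real \<Rightarrow> real" and y :: "real^'n"
  assumes V: "V > 0" and H0: "H 0 = 0" and R: "0 < R" "R \<le> H V" and \<beta>: "\<beta> > 0"
    and cont: "continuous_on {0..V} H"
    and deriv: "\<And>s. s \<in> {0..<V} \<Longrightarrow> (H has_real_derivative H1 s) (at s within {0..V})"
    and pos: "\<And>s. s \<in> {0..<V} \<Longrightarrow> H1 s > 0"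
    and cont1: "continuous_on {0..<V} H1"
    and ode: "\<And>s. s \<in> {0..<V} \<Longrightarrow> s = 0 \<or> CARD('n) = 1 \<Longrightarrow> H1 s * f s = \<beta>"
    and alg: "\<And>s. s \<in> {0..<V} \<Longrightarrow> CARD('n) \<noteq> 1 \<Longrightarrow> H s * f s = \<beta> * s \<and> H1 s * f s \<le> \<beta>"
  obtains u :: "real^'n \<Rightarrow> real" where "radial_about y (cball y R) u"
    "\<And>x. x \<in> ball y R \<Longrightarrow> \<beta> * largest_eigenvalue (hessian u x) = - f (norm (gradient u x))"
    "\<And>x. x \<in> sphere y R \<Longrightarrow> u x = 0" "R < H V \<Longrightarrow> C2_closure (ball y R) u"
    "C2_on (ball y R) u" "C1_closure (ball y R) u" "C1_norm (ball y R) u \<le> V * (R + 1)"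
proof -
  obtain v where v: "\<And>r. r \<in> {0..R} \<Longrightarrow> v r \<in> {0..V}" "\<And>r. r \<in> {0..R} \<Longrightarrow> H (v r) = r"
    "continuous_on {0..R} v" "v 0 = 0" "\<And>r. r \<in> {0..R} \<Longrightarrow> r < H V \<Longrightarrow> v r \<in> {0..<V}"
    and dv: "\<And>r. r \<in> {0..R} \<Longrightarrow> r < H V \<Longrightarrow>
       (v has_real_derivative inverse (H1 (v r))) (at r within {0..R})"
    using increasing_inverse[OF V H0 less_imp_le[OF R(1)] R(2) cont deriv pos] by blast
  define v1 where "v1 r = inverse (H1 (v r))" for r
  have cont_deriv: "continuous_on D v1" if "D \<subseteq> {0..R}" "\<And>r. r \<in> D \<Longrightarrow> r < H V" for D
  proof -
    have "v r \<in> {0..<V}" if "r \<in> D" for r using that \<open>D \<subseteq> {0..R}\<close> \<open>r \<in> D \<Longrightarrow> r < H V\<close> v(5) by blast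
    moreover have "continuous_on D v" using v(3) \<open>D \<subseteq> {0..R}\<close> by (rule continuous_on_subset)
    ultimately show ?thesis unfolding v1_def
      using pos by (intro continuous_on_inverse continuous_on_compose2[OF cont1]) fastforce+
  qed
  interpret radial_profile R v v1
  proof
    show "(v has_real_derivative v1 r) (at r within {0..R})" if "r \<in> {0..<R}" for r
      using dv[of r] that R unfolding v1_def by simp
    show "continuous_on {0..<R} v1" by (rule cont_deriv) (use R in auto)
  qed (use R v in auto)
  have pde: "\<beta> * largest_eigenvalue (hessian (u y) x) = - f (norm (gradient (u y) x))"
    if x: "x \<in> ball y R" for x
  proof -
    define r where "r = norm (x - y)"
    have r: "r \<in> {0..R}" "r < H V"
      using x R by (auto simp: r_def dist_norm norm_minus_commute)
    note vr = v(5)[OF r]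
    have G: "norm (gradient (u y) x) = v r"
      using vr by (simp add: gradient_u[OF x] norm_grad r_def)
    have hess: "hessian (u y) x = radial_matrix (w r) (v1 r - w r) (sgn (x - y))"
      by (simp add: hessian_u[OF x] hess_def r_def)
    \<comment> \<open>Since \<open>v1\<close> is the reciprocal of \<open>H1\<close> along
      \<open>v\<close>, assumption \<open>ode\<close> becomes the differential equation for
      \<open>v\<close>. The case \<open>r = 0\<close> matters in every dimension: at the center all
      eigenvalues equal \<open>- v1 0\<close>.\<close>
    have v1_ode: "\<beta> * v1 r = f (v r)" if "r = 0 \<or> CARD('n) = 1"
      using ode[OF vr] pos[OF vr] that v(4) by (auto simp: v1_def field_simps)
    show ?thesis
    proof (cases "x = y")
      case True
      then have "r = 0" by (simp add: r_def)
      then show ?thesis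
        using v1_ode unfolding hess G by (simp add: w_def largest_eigenvalue_radial_matrix_0)
    next
      case False
      then have s: "norm (sgn (x - y)) = 1" and r0: "r > 0" by (simp_all add: norm_sgn r_def)
      show ?thesis
      proof (cases "CARD('n) = 1")
        case True
        then show ?thesis
          using v1_ode unfolding hess G largest_eigenvalue_radial_matrix_dim1[OF s True] by simp
      next
        case dim: False
        moreover have "0 < CARD('n)" by simp
        ultimately have "CARD('n) \<ge> 2" by linarith
        \<comment> \<open>Since \<open>H (v r) = r\<close>, the equality says that the tangential
          eigenvalue \<open>- w r\<close> solves the equation.\<close>
        have eq: "r * f (v r) = \<beta> * v r" and le: "H1 (v r) * f (v r) \<le> \<beta>"
          using alg[OF vr dim] v(2)[OF r(1)] by auto
        have w: "\<beta> * w r = f (v r)" using eq r0 by (simp add: w_def field_simps)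
        \<comment> \<open>The inequality for \<open>H1\<close> becomes
          \<open>w r \<le> v1 r\<close>, which makes \<open>- w r\<close> the largest
          eigenvalue.\<close>
        have "f (v r) \<le> \<beta> * v1 r" using le pos[OF vr] by (simp add: v1_def field_simps)
        then have "w r \<le> v1 r" using \<beta> by (simp flip: w)
        then have "largest_eigenvalue (hessian (u y) x) = - w r"
          unfolding hess using s \<open>CARD('n) \<ge> 2\<close> by (intro largest_eigenvalue_radial_matrix) auto
        then show ?thesis using w G by simp
      qed
    qed
  qed
  show ?thesis
  proof (rule that[of "u y"])
    show "radial_about y (cball y R) (u y)" by (auto simp: radial_about_def u_def)
    show "u y x = 0" if "x \<in> sphere y R" for x
      using that by (simp add: u_def \<phi>_def dist_norm norm_minus_commute)
    show "C2_closure (ball y R) (u y)" if "R < H V"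
      by (rule C2_closure_u[OF cont_deriv]) (use that in auto)
    show "C1_norm (ball y R) (u y) \<le> V * (R + 1)" by (rule C1_norm_u[OF v(1)])
  qed (use pde C2_on_u C1_closure_u in auto)
qed

section \<open>The critical slope and the explicit inverse profile\<close>

text \<open>The derivative of \<open>\<beta> * s / (M + b * s powr p)\<close> has the sign of
  \<open>M - (p - 1) * b * s powr p\<close>. So \<open>V\<close> is the point where this function is
  largest on the nonnegative reals, and \<open>Rbar\<close> is its maximum.\<close>

lemma critical_slope:
  fixes p \<beta> b M Rbar :: real
  assumes "p > 1" "\<beta> > 0" "b > 0" "M > 0"
    and Rbar: "Rbar = \<beta> * (p - 1) powr ((p - 1) / p) / (p * b powr (1 / p) * M powr ((p - 1) / p))"
  defines "V \<equiv> (\<beta> / (Rbar * p * b)) powr (1 / (p - 1))"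
  shows "V > 0" "(p - 1) * b * V powr p = M" "\<beta> * V / (M + b * V powr p) = Rbar"
proof -
  define q where "q = (p - 1) / p"
  \<comment> \<open>\<open>K\<close> is the positive solution of
    \<open>(p - 1) * b * K powr p = M\<close>; the calculation below identifies it with
    \<open>V\<close>.\<close>
  define K where "K = (M / (b * (p - 1))) powr (1 / p)"
  have K: "K > 0" using assms by (simp add: K_def)
  have "b powr (1 / p) * b powr q = b powr 1"
    using assms by (simp add: q_def field_simps flip: powr_add)
  then have bq: "b powr (1 / p) * b powr q = b" using assms by simp
  have Kq: "K powr (p - 1) = M powr q / (b powr q * (p - 1) powr q)"
    using assms by (simp add: K_def q_def powr_powr powr_divide powr_mult)
  have "\<beta> / (Rbar * p * b) = b powr (1 / p) * M powr q / ((p - 1) powr q * b)"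
    using assms unfolding Rbar q_def[symmetric] by (simp add: field_simps)
  \<comment> \<open>Splitting \<open>b\<close> into its powers \<open>1 / p\<close> and
    \<open>q\<close>, whose exponents add up to 1, lets \<open>b powr (1 / p)\<close>
    cancel.\<close>
  also have "\<dots> = b powr (1 / p) * M powr q / ((p - 1) powr q * (b powr (1 / p) * b powr q))"
    by (simp only: bq)
  also have "\<dots> = K powr (p - 1)" using assms unfolding Kq by (simp add: field_simps)
  finally have slope: "\<beta> / (Rbar * p * b) = K powr (p - 1)" .
  have VK: "V = K" unfolding V_def slope using assms K by (simp add: powr_powr)
  show "V > 0" using VK K by simp
  have "K powr p = M / (b * (p - 1))" using assms by (simp add: K_def powr_powr)
  then show Kp: "(p - 1) * b * V powr p = M" using assms by (simp add: VK)
  have Rb: "Rbar > 0" using assms by simp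
  have "V powr p = V * V powr (p - 1)" using \<open>V > 0\<close> by (simp add: powr_mult_base)
  also have "V powr (p - 1) = \<beta> / (Rbar * p * b)" by (simp add: VK slope)
  finally have "V powr p = V * (\<beta> / (Rbar * p * b))" .
  then have "b * V powr p * p * Rbar = \<beta> * V" using assms(1-4) Rb by (simp only:) simp
  moreover have "M + b * V powr p = b * V powr p * p" using Kp by (simp add: algebra_simps)
  ultimately show "\<beta> * V / (M + b * V powr p) = Rbar"
    using assms(1-4) \<open>V > 0\<close> by (simp add: divide_eq_eq mult.commute)
qed

text \<open>For \<open>s > 0\<close> this is the quotient rule. At 0 the difference quotient is
  \<open>\<beta> / (M + b * s powr p)\<close>, which tends to \<open>\<beta> / M\<close> because
  \<open>p > 0\<close>.\<close>

lemma has_real_derivative_quotient_powr: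
  fixes p \<beta> b M :: real
  assumes "p > 1" "b > 0" "M > 0" "s \<ge> 0" "s < V"
  shows "((\<lambda>s. \<beta> * s / (M + b * s powr p)) has_real_derivative
      \<beta> * (M - (p - 1) * b * s powr p) / (M + b * s powr p)\<^sup>2) (at s within {0..V})"
proof (cases "s = 0")
  case True
  have "\<forall>\<^sub>F s in at 0 within {0..V}. 0 \<le> s"
    by (auto simp: eventually_at intro!: exI[of _ 1])
  then have "((\<lambda>s. s powr p) \<longlongrightarrow> 0 powr p) (at 0 within {0..V})"
    using assms by (intro tendsto_powr') auto
  then have "((\<lambda>s. \<beta> / (M + b * s powr p)) \<longlongrightarrow> \<beta> / (M + b * 0 powr p)) (at 0 within {0..V})"
    using assms by (intro tendsto_divide tendsto_add tendsto_mult tendsto_const) auto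
  then have "((\<lambda>s. \<beta> / (M + b * s powr p)) \<longlongrightarrow> \<beta> / M) (at 0 within {0..V})" by simp
  then have "((\<lambda>s. (\<beta> * s / (M + b * s powr p) - \<beta> * 0 / (M + b * 0 powr p)) / (s - 0)) \<longlongrightarrow> \<beta> / M)
      (at 0 within {0..V})"
    by (rule Lim_transform_eventually) (auto simp: eventually_at_filter)
  then show ?thesis
    using True assms by (simp add: has_field_derivative_iff power2_eq_square)
next
  case False
  then have s: "s > 0" using assms by simp
  have f: "M + b * s powr p > 0" using assms by (simp add: add_pos_nonneg)
  have "((\<lambda>s. M + b * s powr p) has_real_derivative 0 + b * (p * s powr (p - 1))) (at s)"
    using s by (intro DERIV_add DERIV_const DERIV_cmult has_real_derivative_powr)
  from DERIV_divide[OF DERIV_cmult_Id[of \<beta>] this]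
  have "((\<lambda>s. \<beta> * s / (M + b * s powr p)) has_real_derivative
      (\<beta> * (M + b * s powr p) - \<beta> * s * (0 + b * (p * s powr (p - 1))))
        / ((M + b * s powr p) * (M + b * s powr p))) (at s)"
    using f by simp
  then have D: "((\<lambda>s. \<beta> * s / (M + b * s powr p)) has_real_derivative
      (\<beta> * (M + b * s powr p) - \<beta> * b * p * (s * s powr (p - 1))) / (M + b * s powr p)\<^sup>2) (at s)"
    by (simp add: power2_eq_square mult_ac)
  have "s * s powr (p - 1) = s powr p" using s by (simp add: powr_mult_base)
  then have "\<beta> * (M + b * s powr p) - \<beta> * b * p * (s * s powr (p - 1))
      = \<beta> * (M - (p - 1) * b * s powr p)"
    by (simp only:) (simp add: algebra_simps)
  with D show ?thesis
    by (metis has_field_derivative_at_within)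
qed

section \<open>Choice of the inverse profile according to the dimension\<close>

theorem proposition1:
  fixes p \<beta> b M R Rbar :: real and y :: "real^'n"
  assumes "p > 1" and "\<beta> > 0" and "b > 0" and "M > 0" and "R > 0"
    and Rbar: "Rbar = \<beta> * (p - 1) powr ((p - 1) / p)
                      / (p * b powr (1 / p) * M powr ((p - 1) / p))"
    and "R \<le> Rbar"
  shows "\<exists>u :: real^'n \<Rightarrow> real.
           radial_about y (cball y R) u
         \<and> (\<forall>x\<in>ball y R. \<beta> * largest_eigenvalue (hessian u x)
                           + b * norm (gradient u x) powr p = - M)
         \<and> (\<forall>x\<in>sphere y R. u x = 0)
         \<and> (R < Rbar \<longrightarrow> C2_closure (ball y R) u)
         \<and> (R = Rbar \<longrightarrow> C2_on (ball y R) u \<and> C1_closure (ball y R) u)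
         \<and> C1_norm (ball y R) u \<le> (\<beta> / (Rbar * p * b)) powr (1 / (p - 1)) * (Rbar + 1)"
proof -
  define V where "V = (\<beta> / (Rbar * p * b)) powr (1 / (p - 1))"
  define f where "f s = M + b * s powr p" for s
  note V = critical_slope[OF assms(1-4) Rbar, folded V_def]
  have f_pos: "f s > 0" for s using assms by (simp add: f_def add_pos_nonneg)
  \<comment> \<open>Below the critical slope the numerator of the derivative of the quotient stays
    positive.\<close>
  have f_less: "(p - 1) * b * s powr p < M" if "s \<in> {0..<V}" for s
  proof -
    have "s powr p < V powr p" using that assms by (intro powr_less_mono2) auto
    then have "(p - 1) * b * s powr p < (p - 1) * b * V powr p" using assms by simp
    then show ?thesis using V by simp
  qed
  have cont_f: "continuous_on {0..V} f" unfolding f_def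
    using assms by (intro continuous_intros continuous_on_powr') auto
  obtain H H1 :: "real \<Rightarrow> real" where H: "H 0 = 0" "Rbar \<le> H V" "continuous_on {0..V} H"
    "\<And>s. s \<in> {0..<V} \<Longrightarrow> (H has_real_derivative H1 s) (at s within {0..V})"
    "\<And>s. s \<in> {0..<V} \<Longrightarrow> H1 s > 0" "continuous_on {0..<V} H1"
    "\<And>s. s \<in> {0..<V} \<Longrightarrow> s = 0 \<or> CARD('n) = 1 \<Longrightarrow> H1 s * f s = \<beta>"
    "\<And>s. s \<in> {0..<V} \<Longrightarrow> CARD('n) \<noteq> 1 \<Longrightarrow> H s * f s = \<beta> * s \<and> H1 s * f s \<le> \<beta>"
  proof (cases "CARD('n) = 1")
    case True
    let ?g = "\<lambda>s. \<beta> / f s"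
    have cont_g: "continuous_on {0..V} ?g"
      using f_pos by (intro continuous_intros cont_f) (metis less_irrefl)
    \<comment> \<open>\<open>Rbar = \<beta> * V / f V\<close> is the integral of a constant over
      \<open>{0..V}\<close>. As \<open>f\<close> is increasing, this constant is the minimum of
      \<open>\<beta> / f s\<close>, whence the comparison.\<close>
    have "Rbar = integral {0..V} (\<lambda>s. \<beta> / f V)"
      using V by (simp add: f_def mult.commute)
    also have "\<dots> \<le> integral {0..V} ?g"
    proof (rule integral_le)
      fix s assume "s \<in> {0..V}"
      then have "f s \<le> f V" using assms by (simp add: f_def powr_mono2)
      then show "\<beta> / f V \<le> \<beta> / f s" using assms f_pos by (simp add: frac_le)
    qed (use cont_g in \<open>auto intro: integrable_continuous_real\<close>)
    finally have le: "Rbar \<le> integral {0..V} ?g" .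
    have d: "((\<lambda>x. integral {0..x} ?g) has_real_derivative \<beta> / f s) (at s within {0..V})"
      if "s \<in> {0..V}" for s using integral_has_real_derivative[OF cont_g that] .
    show ?thesis
    proof (rule that[of "\<lambda>s. integral {0..s} ?g" ?g])
      show "continuous_on {0..V} (\<lambda>s. integral {0..s} ?g)" using d by (rule DERIV_continuous_on)
      show "continuous_on {0..<V} ?g" using cont_g by (rule continuous_on_subset) auto
      show "\<beta> / f s * f s = \<beta>" for s using f_pos[of s] by simp
    qed (use le d assms f_pos True in auto)
  next
    case False
    let ?H = "\<lambda>s. \<beta> * s / f s"
    let ?H1 = "\<lambda>s. \<beta> * (M - (p - 1) * b * s powr p) / (f s)\<^sup>2"
    have mult: "?H1 s * f s = \<beta> * (M - (p - 1) * b * s powr p) / f s" for s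
      using f_pos[of s] by (simp add: power2_eq_square)
    show ?thesis
    proof (rule that[of ?H ?H1])
      show "continuous_on {0..V} ?H"
        using f_pos by (intro continuous_intros cont_f) (metis less_irrefl)
      have "continuous_on {0..<V} f" using cont_f by (rule continuous_on_subset) auto
      then show "continuous_on {0..<V} ?H1"
        using f_pos assms by (intro continuous_intros continuous_on_powr') (auto simp: less_imp_neq[symmetric])
      show "(?H has_real_derivative ?H1 s) (at s within {0..V})" if "s \<in> {0..<V}" for s
        unfolding f_def by (rule has_real_derivative_quotient_powr) (use that assms in auto)
      show "?H1 s > 0" if "s \<in> {0..<V}" for s
        using f_less[OF that] f_pos[of s] assms by simp
      show "Rbar \<le> ?H V" using V by (simp add: f_def)
      \<comment> \<open>The dimension is not one here, so only \<open>s = 0\<close> remains, where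
        \<open>f s = M\<close> and the product is \<open>\<beta> * M / M\<close>.\<close>
      show "?H1 s * f s = \<beta>" if "s = 0 \<or> CARD('n) = 1" for s
        using that False assms unfolding mult by (auto simp: f_def)
      \<comment> \<open>The two sides differ by \<open>p * b * s powr p\<close>, which is
        nonnegative; this yields \<open>?H1 s * f s \<le> \<beta>\<close>.\<close>
      have "M - (p - 1) * b * s powr p \<le> f s" for s
        unfolding f_def using assms by (simp add: algebra_simps add_increasing)
      then have "\<beta> * (M - (p - 1) * b * s powr p) / f s \<le> \<beta>" for s
        using assms f_pos[of s] by (simp add: pos_divide_le_eq)
      then show "?H s * f s = \<beta> * s \<and> ?H1 s * f s \<le> \<beta>" for s
        unfolding mult using f_pos[of s] by simp
    qed simp
  qed
  have "R \<le> H V" using H assms by simp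
  obtain u :: "real^'n \<Rightarrow> real" where u: "radial_about y (cball y R) u"
    "\<And>x. x \<in> ball y R \<Longrightarrow> \<beta> * largest_eigenvalue (hessian u x) = - f (norm (gradient u x))"
    "\<And>x. x \<in> sphere y R \<Longrightarrow> u x = 0" "R < H V \<Longrightarrow> C2_closure (ball y R) u"
    "C2_on (ball y R) u" "C1_closure (ball y R) u" "C1_norm (ball y R) u \<le> V * (R + 1)"
    using radial_solution[where f = f and y = y, OF V(1) H(1) \<open>R > 0\<close> \<open>R \<le> H V\<close> \<open>\<beta> > 0\<close> H(3-8)] by blast
  have "V * (R + 1) \<le> V * (Rbar + 1)" using V assms by simp
  then have "C1_norm (ball y R) u \<le> V * (Rbar + 1)" using u(7) by simp
  moreover have "R < Rbar \<Longrightarrow> R < H V" using H(2) by simp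
  moreover have "\<beta> * largest_eigenvalue (hessian u x) + b * norm (gradient u x) powr p = - M"
    if "x \<in> ball y R" for x using u(2)[OF that] by (simp add: f_def)
  ultimately show ?thesis using u unfolding V_def by (intro exI[of _ u] conjI ballI impI) auto
qed

end
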